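(* Let $p\ge5$ be a prime, let $n$ be a positive integer, let $H=\langle z,w\rangle\cong 2\cdot \mathrm{D}_{2n}$ be a subgroup of $G=\mathrm{SL}(2,p)$, let $x\in G$, and let $S=H\cup\{x,x^{-1}\}$, or let $x^2\in H$ and $S=H\cup(xH\cap Hx)$. If $\langle S\rangle=G$, then $|S^3|\ge|S|^{1+\delta}$, where $\delta=\log_2(3)/5$.
   Context: For a subset $S$ of a group, $S^3=\{abc: a,b,c\in S\}$. $\mathrm{D}_{2n}$ denotes the dihedral group of order $2n$, and $2\cdot\mathrm{D}_{2n}$ denotes the preimage in $\mathrm{SL}(2,p)$ of such a subgroup of $\mathrm{PSL}(2,p)$; it has order $4n$ and is the generalized quaternion group $Q_{4n}$ with presentation $\langle z,w\mid z^{2n}, w^4, z^n=w^2, w^{-1}zw=z^{-1}\rangle$, where $w^2=-I$. *)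

theory Defs
  imports
    "HOL-Analysis.Analysis"
    "HOL-Algebra.Algebra"
    "Berlekamp_Zassenhaus.Finite_Field"
begin

text \<open>The prime p is the cardinality of the index type \<open>'p::prime_card\<close>, and \<open>'p mod_ring\<close> is
  the field with p elements. Every prime is the cardinality of such a type.\<close>

definition SL2 :: "('p::prime_card mod_ring ^ 2 ^ 2) monoid" where
  "SL2 = \<lparr>carrier = {A. det A = 1}, mult = (**), one = mat 1\<rparr>"

definition plus_minus_I :: "('p::prime_card mod_ring ^ 2 ^ 2) set" where
  "plus_minus_I = {mat 1, - mat 1}"

definition PSL2 :: "('p::prime_card mod_ring ^ 2 ^ 2) set monoid" where
  "PSL2 = SL2 Mod plus_minus_I"

text \<open>The relations make D a quotient of the dihedral group of order 2n (for \<open>n \<ge> 1\<close>); the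
  condition on the order makes it isomorphic to that group. The case n = 1 is the group of
  order 2, and n = 2 is the Klein four-group.\<close>

definition dihedral_group :: "('a, 'b) monoid_scheme \<Rightarrow> nat \<Rightarrow> bool" where
  "dihedral_group D n \<longleftrightarrow>
     group D \<and> order D = 2 * n \<and>
     (\<exists>r \<in> carrier D. \<exists>s \<in> carrier D.
        r [^]\<^bsub>D\<^esub> n = \<one>\<^bsub>D\<^esub> \<and> s [^]\<^bsub>D\<^esub> (2::nat) = \<one>\<^bsub>D\<^esub> \<and>
        inv\<^bsub>D\<^esub> s \<otimes>\<^bsub>D\<^esub> r \<otimes>\<^bsub>D\<^esub> s = inv\<^bsub>D\<^esub> r \<and>
        generate D {r, s} = carrier D)"

text \<open>H is a subgroup \<open>2\<cdot>D\<^sub>2\<^sub>n\<close> of SL(2,p): the full preimage, under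
  SL(2,p) \<open>\<rightarrow>\<close> PSL(2,p), of a dihedral subgroup of order 2n.\<close>

definition double_dihedral :: "('p::prime_card mod_ring ^ 2 ^ 2) set \<Rightarrow> nat \<Rightarrow> bool" where
  "double_dihedral H n \<longleftrightarrow>
     (\<exists>D. subgroup D PSL2 \<and> dihedral_group (PSL2\<lparr>carrier := D\<rparr>) n \<and>
          H = {A \<in> carrier SL2. plus_minus_I #>\<^bsub>SL2\<^esub> A \<in> D})"

text \<open>The generators z, w of H satisfy the relations of the generalized quaternion group
  of order 4n. Since a subgroup \<open>2\<cdot>D\<^sub>2\<^sub>n\<close> has order 4n, these relations then present H.
  The clause \<open>w\<^sup>2 = -I\<close> records that \<open>w\<^sup>2\<close> is the central involution of SL(2,p).\<close>

definition quaternion_relations ::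
  "'p::prime_card mod_ring ^ 2 ^ 2 \<Rightarrow> 'p mod_ring ^ 2 ^ 2 \<Rightarrow> nat \<Rightarrow> bool" where
  "quaternion_relations z w n \<longleftrightarrow>
     z [^]\<^bsub>SL2\<^esub> (2 * n) = \<one>\<^bsub>SL2\<^esub> \<and>
     w [^]\<^bsub>SL2\<^esub> (4::nat) = \<one>\<^bsub>SL2\<^esub> \<and>
     z [^]\<^bsub>SL2\<^esub> n = w [^]\<^bsub>SL2\<^esub> (2::nat) \<and>
     inv\<^bsub>SL2\<^esub> w \<otimes>\<^bsub>SL2\<^esub> z \<otimes>\<^bsub>SL2\<^esub> w = inv\<^bsub>SL2\<^esub> z \<and>
     w [^]\<^bsub>SL2\<^esub> (2::nat) = - mat 1"

lemma group_SL2: "group (SL2 :: ('p::prime_card mod_ring ^ 2 ^ 2) monoid)"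
proof (rule groupI)
  fix A :: "'p mod_ring ^ 2 ^ 2"
  assume "A \<in> carrier SL2"
  hence d: "det A = 1" by (simp add: SL2_def)
  define B :: "'p mod_ring ^ 2 ^ 2" where
    "B = vector [vector [A$2$2, - A$1$2], vector [- A$2$1, A$1$1]]"
  have "det B = 1"
    using d by (simp add: B_def det_2 mult.commute)
  moreover have "B ** A = mat 1"
    using d by (simp add: B_def det_2 matrix_matrix_mult_def mat_def vec_eq_iff forall_2 sum_2
        algebra_simps)
  ultimately show "\<exists>B \<in> carrier SL2. B \<otimes>\<^bsub>SL2\<^esub> A = \<one>\<^bsub>SL2\<^esub>"
    by (auto simp: SL2_def)
qed (auto simp: SL2_def det_mul matrix_mul_assoc)

end

theory Submission
  imports Defs
begin

text \<open>
  Write \<open>K = H \<inter> xHx\<^sup>-\<^sup>1\<close>, \<open>k = |K|\<close> and \<open>|H| = km\<close>. Since \<open>S\<close> contains \<open>H\<close> and \<open>x\<close>, its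
  cube contains the subgroup \<open>H\<close> and the double coset \<open>HxH\<close>, which is disjoint from \<open>H\<close> and has
  \<open>|H|\<^sup>2/k\<close> elements; hence \<open>|S\<^sup>3| \<ge> km(m + 1)\<close>. On the other hand \<open>|S|\<close> is at most \<open>km + 2\<close> in the
  first case and \<open>km + k\<close> in the second, because \<open>xH \<inter> Hx = Kx\<close>. The estimate therefore holds as
  soon as \<open>k\<close> is small and \<open>m\<close> is not too small, and this is where the generation hypothesis enters.

  First, \<open>k \<le> 8\<close>. An element \<open>u\<close> of \<open>K\<close> lying in \<open>\<langle>z\<rangle>\<close> with \<open>u\<^sup>2 \<noteq> \<plusminus>I\<close> would be moved by \<open>x\<close> into \<open>H\<close>,
  and in fact into \<open>\<langle>z\<rangle>\<close>, since every element of \<open>H\<close> outside \<open>\<langle>z\<rangle>\<close> squares to \<open>-I\<close>. Centralizers of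
  noncentral elements of \<open>SL(2,p)\<close> are commutative, so \<open>u\<close>, \<open>z\<close> and the conjugate of \<open>u\<close> have the same
  centralizer; it is then normalized by \<open>z\<close>, \<open>w\<close> and \<open>x\<close>, that is, by the whole group, and a
  commutative normal subset of \<open>SL(2,p)\<close> is central (lemma \<open>commutative_normal_central_SL2\<close>).
  So \<open>K \<inter> \<langle>z\<rangle>\<close> has at most four elements and \<open>K\<close> at most eight.

  Secondly, if \<open>K\<close> is normal in \<open>SL(2,p)\<close>, then \<open>K = {\<plusminus>I}\<close>: conjugating a noncentral element by the
  upper transvections, and negating, produces \<open>2p \<ge> 10\<close> elements
  (lemma \<open>card_normal_noncentral_SL2\<close>). This excludes \<open>m = 1\<close>, where \<open>K = H\<close>. It also shows \<open>k = 2\<close>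
  when \<open>m = 2\<close> in the second case: \<open>K\<close> is normal in \<open>H\<close> by index two, and \<open>x\<close> normalizes \<open>K\<close> because
  \<open>x\<^sup>2 \<in> H\<close>.

  What remains is numerical: \<open>(k(m + 1))\<^sup>1\<^sup>+\<^sup>\<delta> \<le> km(m + 1)\<close> for \<open>m \<ge> 3\<close> and \<open>k \<le> 8\<close>, and
  \<open>(2k + 2)\<^sup>1\<^sup>+\<^sup>\<delta> \<le> 6k\<close> for \<open>m = 2\<close>. The first is an equality for \<open>k = 8\<close>, \<open>m = 3\<close>, where it reads
  \<open>32\<^sup>\<delta> = 3\<close>; this determines \<open>\<delta>\<close>.
\<close>

section \<open>Two estimates for the exponent\<close>

text \<open>In this range the bound \<open>\<delta> \<le> 1/3\<close>, which is \<open>3\<^sup>3 \<le> 2\<^sup>5\<close>, is good enough: cubing turns the claim into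
  \<open>2(k + 1)\<^sup>4 \<le> 27k\<^sup>3\<close>, checked value by value.\<close>

lemma small_set_growth:
  fixes k :: nat
  assumes "2 \<le> k" "k \<le> 8"
  shows "real (2 * k + 2) powr (1 + log 2 3 / 5) \<le> real (6 * k)"
proof -
  let ?s = "real (2 * k + 2)" and ?r = "3 * real k / (real k + 1)"
  have "log 2 3 * 3 = log 2 ((3::real) ^ 3)" by (subst log_nat_power) auto
  also have "\<dots> \<le> log 2 (2 ^ 5)" by (subst log_le_cancel_iff) auto
  also have "\<dots> = 5" by (subst log_nat_power) auto
  finally have "?s powr (log 2 3 / 5) \<le> ?s powr (1/3)"
    by (intro powr_mono) auto
  also have "?s powr (1/3) \<le> (?r ^ 3) powr (1/3)"
  proof (rule powr_mono2)
    have "k \<in> {2,3,4,5,6,7,8}" using assms by auto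
    thus "?s \<le> ?r ^ 3" by (auto simp: power3_eq_cube)
  qed auto
  also have "(?r ^ 3) powr (1/3) = ?r"
  proof -
    have "?r > 0" using assms by simp
    hence "?r ^ 3 = ?r powr 3" by simp
    moreover have "(?r powr 3) powr (1/3) = ?r"
      unfolding powr_powr using \<open>?r > 0\<close> by simp
    ultimately show ?thesis by simp
  qed
  finally have "?s * ?s powr (log 2 3 / 5) \<le> ?s * ?r"
    by (rule mult_left_mono) simp
  moreover have "?s powr (1 + log 2 3 / 5) = ?s * ?s powr (log 2 3 / 5)"
    by (simp add: powr_add)
  moreover have "?s * ?r = real (6 * k)" by (simp add: field_simps)
  ultimately show ?thesis by linarith
qed

text \<open>After replacing \<open>k\<close> by 8, the ratio \<open>t = (m + 1)/4 \<ge> 1\<close> measures the distance from the extremal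
  case \<open>m = 3\<close>. There \<open>32\<^sup>\<delta> = 3\<close>, and the factor \<open>t\<^sup>\<delta> \<le> t\<close> is compensated by \<open>3t \<le> 4t - 1 = m\<close>.\<close>

lemma large_index_growth:
  fixes k m :: nat
  assumes "k \<le> 8" "3 \<le> m"
  shows "real (k * (m + 1)) powr (1 + log 2 3 / 5) \<le> real (k * m * (m + 1))"
proof -
  let ?s = "real (k * (m + 1))" and ?t = "(real m + 1) / 4"
  have "?s \<le> real (8 * (m + 1))" using assms by (simp only: of_nat_le_iff mult_le_mono1)
  hence "?s \<le> 32 * ?t" by simp
  hence "?s powr (log 2 3 / 5) \<le> (32 * ?t) powr (log 2 3 / 5)"
    by (intro powr_mono2) auto
  also have "\<dots> = 32 powr (log 2 3 / 5) * ?t powr (log 2 3 / 5)"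
    by (rule powr_mult)
  also have "(32::real) powr (log 2 3 / 5) = (2 powr 5) powr (log 2 3 / 5)"
    by simp
  also have "\<dots> = 3" unfolding powr_powr by simp
  also have "?t powr (log 2 3 / 5) \<le> ?t powr 1"
  proof (rule powr_mono)
    have "log 2 3 \<le> log 2 ((2::real) ^ 5)"
      by (subst log_le_cancel_iff) auto
    also have "\<dots> = 5" by (subst log_nat_power) auto
    finally show "log 2 3 / 5 \<le> (1::real)" by simp
  qed (use assms in auto)
  also have "3 * ?t powr 1 \<le> real m" using assms by simp
  finally have "?s powr (log 2 3 / 5) \<le> real m" by simp
  hence "?s powr (1 + log 2 3 / 5) \<le> ?s * real m"
    by (simp add: powr_add mult_left_mono del: of_nat_mult)
  thus ?thesis by (simp only: of_nat_mult mult_ac)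
qed

section \<open>Conjugation and double cosets\<close>

definition centralizer :: "('a, 'b) monoid_scheme \<Rightarrow> 'a \<Rightarrow> 'a set" where
  "centralizer G u = {g \<in> carrier G. g \<otimes>\<^bsub>G\<^esub> u = u \<otimes>\<^bsub>G\<^esub> g}"

text \<open>This is \<open>H \<inter> xHx\<^sup>-\<^sup>1\<close>, written so that membership needs no witness.\<close>

definition conj_meet :: "('a, 'b) monoid_scheme \<Rightarrow> 'a set \<Rightarrow> 'a \<Rightarrow> 'a set" where
  "conj_meet G H x = {h \<in> H. inv\<^bsub>G\<^esub> x \<otimes>\<^bsub>G\<^esub> h \<otimes>\<^bsub>G\<^esub> x \<in> H}"

context group
begin

lemma conj_mult:
  assumes "x \<in> carrier G" "a \<in> carrier G" "b \<in> carrier G"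
  shows "inv x \<otimes> (a \<otimes> b) \<otimes> x = (inv x \<otimes> a \<otimes> x) \<otimes> (inv x \<otimes> b \<otimes> x)"
proof -
  have "x \<otimes> (inv x \<otimes> (b \<otimes> x)) = b \<otimes> x" using assms by (simp flip: m_assoc)
  thus ?thesis using assms by (simp add: m_assoc)
qed

lemma conj_inv:
  assumes "x \<in> carrier G" "a \<in> carrier G"
  shows "inv x \<otimes> inv a \<otimes> x = inv (inv x \<otimes> a \<otimes> x)"
  using assms by (simp add: inv_mult_group m_assoc)

lemma conj_conj:
  assumes "x \<in> carrier G" "y \<in> carrier G" "a \<in> carrier G"
  shows "inv (x \<otimes> y) \<otimes> a \<otimes> (x \<otimes> y) = inv y \<otimes> (inv x \<otimes> a \<otimes> x) \<otimes> y"
  using assms by (simp add: inv_mult_group m_assoc)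

text \<open>Clearing the inverse turns statements about conjugates into commutation rules.\<close>

lemma conj_eq_iff:
  assumes "x \<in> carrier G" "a \<in> carrier G" "b \<in> carrier G"
  shows "inv x \<otimes> a \<otimes> x = b \<longleftrightarrow> a \<otimes> x = x \<otimes> b"
  using assms by (simp add: m_assoc inv_solve_left')

lemma subgroup_conj_meet:
  assumes "subgroup H G" "x \<in> carrier G"
  shows "subgroup (conj_meet G H x) G"
proof -
  interpret H: subgroup H G by fact
  show ?thesis
    unfolding conj_meet_def
    using assms(2) H.mem_carrier
    by unfold_locales (auto simp: conj_mult conj_inv)
qed

lemma card_subgroup_dvd:
  assumes "subgroup K G" "subgroup H G" "K \<subseteq> H"
  shows "card K dvd card H"
proof -
  interpret H: group "G\<lparr>carrier := H\<rparr>" using assms(2) by (rule subgroup_imp_group)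
  have "card (rcosets\<^bsub>G\<lparr>carrier := H\<rparr>\<^esub> K) * card K = order (G\<lparr>carrier := H\<rparr>)"
    by (rule H.lagrange) (rule subgroup_incl[OF assms])
  hence "card (rcosets\<^bsub>G\<lparr>carrier := H\<rparr>\<^esub> K) * card K = card H" by (simp add: order_def)
  thus ?thesis by (metis dvd_triv_right)
qed

text \<open>The fibres of \<open>(a, b) \<mapsto> axb\<close> on \<open>H \<times> H\<close> have at most \<open>|H \<inter> xHx\<^sup>-\<^sup>1|\<close> elements: if
  \<open>cxd = axb\<close>, then \<open>a\<^sup>-\<^sup>1c = x(bd\<^sup>-\<^sup>1)x\<^sup>-\<^sup>1\<close> lies in that intersection, and it determines \<open>c\<close> and \<open>d\<close>.\<close>

lemma card_double_coset:
  assumes "subgroup H G" "x \<in> carrier G" "finite H"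
  shows "card H * card H \<le> card (H <#> {x} <#> H) * card (conj_meet G H x)"
proof -
  interpret H: subgroup H G by fact
  define f where "f = (\<lambda>(a, b). a \<otimes> x \<otimes> b)"
  let ?D = "H <#> {x} <#> H" and ?K = "conj_meet G H x"
  have D: "?D = f ` (H \<times> H)" unfolding f_def set_mult_def by force
  have fib: "card {p \<in> H \<times> H. f p = y} \<le> card ?K" if y: "y \<in> ?D" for y
  proof -
    obtain a b where ab: "a \<in> H" "b \<in> H" "y = a \<otimes> x \<otimes> b"
      using y unfolding D f_def by auto
    show ?thesis
    proof (rule card_inj_on_le[of "\<lambda>(c, d). inv a \<otimes> c"])
      have c: "c \<otimes> x = a \<otimes> x \<otimes> (b \<otimes> inv d)" if "c \<in> H" "d \<in> H" "f (c, d) = y" for c d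
        using that ab assms(2) unfolding f_def
        by (metis H.mem_carrier inv_solve_right' m_assoc m_closed inv_closed case_prod_conv)
      show "(\<lambda>(c, d). inv a \<otimes> c) ` {p \<in> H \<times> H. f p = y} \<subseteq> ?K"
      proof safe
        fix c d assume cd: "c \<in> H" "d \<in> H" "y = f (c, d)"
        have "inv a \<otimes> c \<otimes> x = x \<otimes> (b \<otimes> inv d)"
          using c[of c d] cd ab assms(2) by (simp add: inv_solve_left' m_assoc)
        hence "inv x \<otimes> (inv a \<otimes> c) \<otimes> x = b \<otimes> inv d"
          using cd ab assms(2) by (simp add: conj_eq_iff)
        thus "inv a \<otimes> c \<in> ?K" using cd ab by (simp add: conj_meet_def)
      qed
      show "inj_on (\<lambda>(c, d). inv a \<otimes> c) {p \<in> H \<times> H. f p = y}"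
      proof (rule inj_onI, clarify)
        fix c d c' d' assume *: "c \<in> H" "d \<in> H" "y = f (c, d)" "c' \<in> H" "d' \<in> H"
          "f (c', d') = f (c, d)" "inv a \<otimes> c = inv a \<otimes> c'"
        have "c = c'" using * ab by simp
        thus "c = c' \<and> d = d'" using * assms(2) by (simp add: f_def)
      qed
      show "finite ?K" using assms(3) by (simp add: conj_meet_def)
    qed
  qed
  have fin: "finite ?D" unfolding D using assms(3) by simp
  have "card H * card H = card (H \<times> H)" by (simp add: card_cartesian_product)
  also have "H \<times> H = (\<Union>y\<in>?D. {p \<in> H \<times> H. f p = y})" unfolding D by auto
  also have "card \<dots> \<le> (\<Sum>y\<in>?D. card {p \<in> H \<times> H. f p = y})"
    by (rule card_UN_le) fact
  also have "\<dots> \<le> (\<Sum>y\<in>?D. card ?K)" by (rule sum_mono) (rule fib)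
  finally show ?thesis by simp
qed

lemma double_coset_disjoint:
  assumes "subgroup H G" "x \<in> carrier G" "x \<notin> H"
  shows "H \<inter> (H <#> {x} <#> H) = {}"
proof (rule ccontr)
  interpret H: subgroup H G by fact
  assume "H \<inter> (H <#> {x} <#> H) \<noteq> {}"
  then obtain a b where ab: "a \<in> H" "b \<in> H" "a \<otimes> x \<otimes> b \<in> H"
    unfolding set_mult_def by blast
  have "inv a \<otimes> ((a \<otimes> x \<otimes> b) \<otimes> inv b) \<in> H"
    by (rule H.m_closed[OF H.m_inv_closed[OF ab(1)] H.m_closed[OF ab(3) H.m_inv_closed[OF ab(2)]]])
  also have "(a \<otimes> x \<otimes> b) \<otimes> inv b = a \<otimes> x"
    using ab(1,2) assms(2) by (simp add: m_assoc)
  also have "inv a \<otimes> (a \<otimes> x) = x"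
    using ab(1) assms(2) by (simp flip: m_assoc)
  finally show False using assms(3) by blast
qed

lemma coset_meet_eq_conj_meet_coset:
  assumes "subgroup H G" "x \<in> carrier G"
  shows "(x <#\<^bsub>G\<^esub> H) \<inter> (H #> x) = conj_meet G H x #> x"
proof -
  interpret H: subgroup H G by fact
  have eq: "a \<otimes> x = x \<otimes> b \<longleftrightarrow> inv x \<otimes> a \<otimes> x = b" if "a \<in> H" "b \<in> H" for a b
    using that assms(2) conj_eq_iff[of x a b] by auto
  show ?thesis
  proof (intro equalityI subsetI)
    fix y assume "y \<in> (x <#\<^bsub>G\<^esub> H) \<inter> (H #> x)"
    then obtain a b where "a \<in> H" "b \<in> H" "y = a \<otimes> x" "a \<otimes> x = x \<otimes> b"
      by (auto simp: l_coset_def r_coset_def)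
    hence "a \<in> conj_meet G H x" using eq[of a b] by (simp add: conj_meet_def)
    thus "y \<in> conj_meet G H x #> x" using \<open>y = a \<otimes> x\<close> unfolding r_coset_def by blast
  next
    fix y assume "y \<in> conj_meet G H x #> x"
    then obtain a where a: "a \<in> H" "inv x \<otimes> a \<otimes> x \<in> H" "y = a \<otimes> x"
      by (auto simp: r_coset_def conj_meet_def)
    have "a \<otimes> x = x \<otimes> (inv x \<otimes> a \<otimes> x)" using eq a(1,2) by blast
    thus "y \<in> (x <#\<^bsub>G\<^esub> H) \<inter> (H #> x)"
      using a unfolding r_coset_def l_coset_def by blast
  qed
qed

text \<open>Conjugating twice by \<open>x\<close> is conjugating by \<open>x\<^sup>2 \<in> H\<close>, so the second conjugate of \<open>v\<close> stays in \<open>H\<close>.\<close>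

lemma conj_meet_conj_closed:
  assumes "subgroup H G" "x \<in> carrier G" "x \<otimes> x \<in> H" "v \<in> conj_meet G H x"
  shows "inv x \<otimes> v \<otimes> x \<in> conj_meet G H x"
proof -
  interpret H: subgroup H G by fact
  have "inv x \<otimes> (inv x \<otimes> v \<otimes> x) \<otimes> x = inv (x \<otimes> x) \<otimes> v \<otimes> (x \<otimes> x)"
    using assms by (simp add: conj_conj conj_meet_def)
  thus ?thesis using assms by (simp add: conj_meet_def)
qed

text \<open>For \<open>g\<close> outside \<open>K\<close> the cosets \<open>K\<close> and \<open>gK\<close> fill \<open>H\<close>, and \<open>vg\<close>, which is not in \<open>K\<close>, is thus in \<open>gK\<close>.\<close>

lemma index_two_conj_closed:
  assumes "subgroup K G" "subgroup H G" "K \<subseteq> H" "finite H" "card H = 2 * card K"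
    and "g \<in> H" "v \<in> K"
  shows "inv g \<otimes> v \<otimes> g \<in> K"
proof (cases "g \<in> K")
  case True
  thus ?thesis using assms by (simp add: subgroup.m_closed subgroup.m_inv_closed)
next
  case False
  interpret K: subgroup K G by fact
  interpret H: subgroup H G by fact
  have disj: "K \<inter> (g <#\<^bsub>G\<^esub> K) = {}"
  proof (rule ccontr)
    assume "K \<inter> (g <#\<^bsub>G\<^esub> K) \<noteq> {}"
    then obtain v where "v \<in> K" "g \<otimes> v \<in> K" by (auto simp: l_coset_def)
    hence "g \<otimes> v \<otimes> inv v \<in> K" by simp
    thus False using False \<open>v \<in> K\<close> assms(6) by (simp add: m_assoc)
  qed
  have "card (g <#\<^bsub>G\<^esub> K) = card K"
  proof -
    have "g <#\<^bsub>G\<^esub> K = (\<lambda>v. g \<otimes> v) ` K" by (auto simp: l_coset_def)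
    moreover have "inj_on (\<lambda>v. g \<otimes> v) K" using assms(6) by (intro inj_onI) simp
    ultimately show ?thesis by (simp add: card_image)
  qed
  hence "card (K \<union> (g <#\<^bsub>G\<^esub> K)) = card H"
    using disj assms by (subst card_Un_disjoint) (auto simp: l_coset_def intro: finite_subset)
  moreover have "K \<union> (g <#\<^bsub>G\<^esub> K) \<subseteq> H" using assms by (auto simp: l_coset_def)
  ultimately have eq: "K \<union> (g <#\<^bsub>G\<^esub> K) = H" using assms(4) by (intro card_subset_eq)
  have "v \<otimes> g \<notin> K"
  proof
    assume "v \<otimes> g \<in> K"
    hence "inv v \<otimes> (v \<otimes> g) \<in> K" using assms(7) by simp
    thus False using False assms by (simp flip: m_assoc)
  qed
  moreover have "v \<otimes> g \<in> H" using assms(3,6,7) by (intro H.m_closed) auto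
  ultimately obtain u where u: "u \<in> K" "v \<otimes> g = g \<otimes> u"
    using eq unfolding l_coset_def by blast
  have "inv g \<otimes> v \<otimes> g = u" using u assms(6,7) by (subst conj_eq_iff) auto
  thus ?thesis using u by simp
qed

text \<open>Finiteness of \<open>N\<close> is what allows inverses of generators: an injective map of \<open>N\<close> into itself is onto.\<close>

lemma conj_closed_generate:
  assumes "finite N" "N \<subseteq> carrier G" "A \<subseteq> carrier G"
    and cl: "\<And>s v. s \<in> A \<Longrightarrow> v \<in> N \<Longrightarrow> inv s \<otimes> v \<otimes> s \<in> N"
  shows "g \<in> generate G A \<Longrightarrow> v \<in> N \<Longrightarrow> inv g \<otimes> v \<otimes> g \<in> N"
proof (induction arbitrary: v rule: generate.induct)
  case one
  thus ?case using assms(2) by auto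
next
  case (incl h)
  thus ?case by (rule cl)
next
  case (inv h)
  have h: "h \<in> carrier G" using inv assms by auto
  have "inj_on (\<lambda>v. inv h \<otimes> v \<otimes> h) N"
    using h assms(2) by (intro inj_onI) (simp add: subset_iff)
  hence "(\<lambda>v. inv h \<otimes> v \<otimes> h) ` N = N"
    using assms(1) cl[OF inv(1)] by (intro endo_inj_surj) auto
  hence "v \<in> (\<lambda>v. inv h \<otimes> v \<otimes> h) ` N" using inv(2) by simp
  then obtain u where u: "u \<in> N" "inv h \<otimes> u \<otimes> h = v" by (rule imageE) simp
  have "inv (inv h) \<otimes> v \<otimes> inv h = u"
  proof -
    have "inv (inv h) \<otimes> v \<otimes> inv h = inv (h \<otimes> inv h) \<otimes> u \<otimes> (h \<otimes> inv h)"
      unfolding u(2)[symmetric] using u(1) h assms(2) by (intro conj_conj[symmetric]) auto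
    also have "\<dots> = u" using u(1) h assms(2) by auto
    finally show ?thesis .
  qed
  thus ?case using u by simp
next
  case (eng h1 h2)
  have "h1 \<in> carrier G" "h2 \<in> carrier G"
    using eng assms(3) generate_in_carrier by auto
  thus ?case using eng.IH eng.prems assms(2) by (subst conj_conj) auto
qed

section \<open>Centralizers and dicyclic groups\<close>

lemma centralizer_conj:
  assumes "y \<in> carrier G" "u \<in> carrier G" "g \<in> centralizer G u"
  shows "inv y \<otimes> g \<otimes> y \<in> centralizer G (inv y \<otimes> u \<otimes> y)"
  using assms conj_mult[of y g u] conj_mult[of y u g] by (simp add: centralizer_def)

lemma subgroup_centralizer:
  assumes "u \<in> carrier G"
  shows "subgroup (centralizer G u) G"
proof (rule subgroupI)
  show "centralizer G u \<noteq> {}" using assms by (auto simp: centralizer_def)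
next
  fix a assume "a \<in> centralizer G u"
  hence a: "a \<in> carrier G" "a \<otimes> u = u \<otimes> a" by (auto simp: centralizer_def)
  have "inv a \<otimes> u \<otimes> a = u" using a assms by (subst conj_eq_iff) auto
  hence "inv a \<otimes> u = u \<otimes> inv a" using a assms by (simp add: inv_solve_right)
  thus "inv a \<in> centralizer G u" using a by (simp add: centralizer_def)
next
  fix a b assume "a \<in> centralizer G u" "b \<in> centralizer G u"
  hence ab: "a \<in> carrier G" "a \<otimes> u = u \<otimes> a" "b \<in> carrier G" "b \<otimes> u = u \<otimes> b"
    by (auto simp: centralizer_def)
  have "a \<otimes> b \<otimes> u = a \<otimes> (u \<otimes> b)"
    using ab(1,3) assms unfolding ab(4)[symmetric] by (rule m_assoc)
  also have "\<dots> = a \<otimes> u \<otimes> b" using ab(1,3) assms by (simp add: m_assoc)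
  also have "\<dots> = u \<otimes> a \<otimes> b" using ab by simp
  also have "\<dots> = u \<otimes> (a \<otimes> b)" using ab assms by (simp add: m_assoc)
  finally show "a \<otimes> b \<in> centralizer G u" using ab by (simp add: centralizer_def)
qed (auto simp: centralizer_def)

lemma generate_singleton_commute:
  assumes "z \<in> carrier G" "u \<in> generate G {z}" "v \<in> generate G {z}"
  shows "u \<otimes> v = v \<otimes> u"
proof -
  obtain i j :: int where "u = z [^] i" "v = z [^] j"
    using assms by (auto simp: generate_pow)
  thus ?thesis using assms(1) by (simp add: add.commute flip: int_pow_mult)
qed

lemma conj_inverts_generate:
  assumes "z \<in> carrier G" "w \<in> carrier G" "inv w \<otimes> z \<otimes> w = inv z"
    and "u \<in> generate G {z}"
  shows "inv w \<otimes> u \<otimes> w = inv u"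
  using assms(4)
proof induction
  case one
  show ?case using assms(2) by simp
next
  case (incl h)
  thus ?case using assms(3) by simp
next
  case (inv h)
  hence "h = z" by simp
  thus ?case using assms by (simp add: conj_inv)
next
  case (eng h1 h2)
  have c: "h1 \<in> carrier G" "h2 \<in> carrier G"
    using eng assms(1) generate_in_carrier[of "{z}"] by auto
  have "inv w \<otimes> (h1 \<otimes> h2) \<otimes> w = inv h1 \<otimes> inv h2"
    using eng c assms(2) by (simp add: conj_mult)
  also have "\<dots> = inv (h2 \<otimes> h1)" using c by (simp add: inv_mult_group)
  also have "h2 \<otimes> h1 = h1 \<otimes> h2" using assms(1) eng by (intro generate_singleton_commute)
  finally show ?case .
qed

text \<open>As \<open>w\<close> inverts \<open>u\<close>, the factors \<open>u\<close> cancel in \<open>uwuw = wu\<^sup>-\<^sup>1uw\<close>.\<close>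

lemma dicyclic_square:
  assumes "z \<in> carrier G" "w \<in> carrier G" "inv w \<otimes> z \<otimes> w = inv z"
    and "u \<in> generate G {z}"
  shows "(u \<otimes> w) \<otimes> (u \<otimes> w) = w \<otimes> w"
proof -
  have u: "u \<in> carrier G" using assms(1,4) generate_in_carrier[of "{z}"] by auto
  have "inv w \<otimes> u \<otimes> w = inv u" by (rule conj_inverts_generate[OF assms])
  hence "u \<otimes> w = w \<otimes> inv u" using u assms(2) by (subst (asm) conj_eq_iff) auto
  hence "(u \<otimes> w) \<otimes> (u \<otimes> w) = (w \<otimes> inv u) \<otimes> (u \<otimes> w)" by simp
  also have "\<dots> = w \<otimes> ((inv u \<otimes> u) \<otimes> w)" using u assms(2) by (simp only: m_assoc inv_closed m_closed)
  finally show ?thesis using u assms(2) by simp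
qed

text \<open>Since \<open>w\<close> inverts \<open>\<langle>z\<rangle>\<close> and \<open>w\<^sup>2 \<in> \<langle>z\<rangle>\<close>, the two cosets \<open>\<langle>z\<rangle>\<close> and \<open>\<langle>z\<rangle>w\<close> already form a subgroup.\<close>

lemma dicyclic_cases:
  assumes "z \<in> carrier G" "w \<in> carrier G" "inv w \<otimes> z \<otimes> w = inv z"
    and "w \<otimes> w \<in> generate G {z}" "g \<in> generate G {z, w}"
  shows "g \<in> generate G {z} \<union> (generate G {z} #> w)"
proof -
  let ?Z = "generate G {z}"
  interpret Z: subgroup ?Z G using assms(1) by (intro generate_is_subgroup) auto
  have sw: "w \<otimes> u = inv u \<otimes> w" if "u \<in> ?Z" for u
  proof -
    have "inv w \<otimes> inv u \<otimes> w = inv (inv u)"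
      using that by (intro conj_inverts_generate[OF assms(1-3)]) auto
    thus ?thesis using that assms(2) by (subst (asm) conj_eq_iff) auto
  qed
  have "subgroup (?Z \<union> (?Z #> w)) G"
  proof (rule subgroupI)
    show "?Z \<union> (?Z #> w) \<subseteq> carrier G" using assms(2) by (auto simp: r_coset_def)
  next
    show "?Z \<union> (?Z #> w) \<noteq> {}" using Z.one_closed by blast
  next
    fix a assume "a \<in> ?Z \<union> (?Z #> w)"
    then consider "a \<in> ?Z" | u where "u \<in> ?Z" "a = u \<otimes> w" by (auto simp: r_coset_def)
    thus "inv a \<in> ?Z \<union> (?Z #> w)"
    proof cases
      case (2 u)
      have "a \<otimes> a = w \<otimes> w" using 2 dicyclic_square[OF assms(1-3)] by simp
      moreover have "a \<in> carrier G" using 2 assms(2) by auto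
      ultimately have "inv a = inv (w \<otimes> w) \<otimes> a"
        using assms(2) by (metis inv_closed inv_mult_group inv_solve_right m_closed)
      also have "\<dots> = (inv (w \<otimes> w) \<otimes> u) \<otimes> w" using 2 assms(2) by (simp add: m_assoc)
      finally show ?thesis using 2 assms(4) unfolding r_coset_def by auto
    qed auto
  next
    fix a b assume ab: "a \<in> ?Z \<union> (?Z #> w)" "b \<in> ?Z \<union> (?Z #> w)"
    consider "a \<in> ?Z" "b \<in> ?Z" | u where "a \<in> ?Z" "u \<in> ?Z" "b = u \<otimes> w"
      | u where "b \<in> ?Z" "u \<in> ?Z" "a = u \<otimes> w"
      | u v where "u \<in> ?Z" "a = u \<otimes> w" "v \<in> ?Z" "b = v \<otimes> w"
      using ab by (auto simp: r_coset_def)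
    thus "a \<otimes> b \<in> ?Z \<union> (?Z #> w)"
    proof cases
      case 1
      thus ?thesis by simp
    next
      case (2 u)
      hence "a \<otimes> b = (a \<otimes> u) \<otimes> w" using assms(2) by (simp add: m_assoc)
      thus ?thesis using 2 unfolding r_coset_def by auto
    next
      case (3 u)
      hence "a \<otimes> b = u \<otimes> (w \<otimes> b)" using assms(2) by (simp add: m_assoc)
      also have "\<dots> = (u \<otimes> inv b) \<otimes> w" using 3 assms(2) by (simp add: sw m_assoc)
      finally show ?thesis using 3 unfolding r_coset_def by auto
    next
      case (4 u v)
      hence "a \<otimes> b = u \<otimes> (w \<otimes> v) \<otimes> w" using assms(2) by (simp add: m_assoc)
      also have "\<dots> = (u \<otimes> inv v) \<otimes> (w \<otimes> w)" using 4 assms(2) by (simp add: sw m_assoc)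
      finally show ?thesis using 4 assms(4) by auto
    qed
  qed
  moreover have "{z, w} \<subseteq> ?Z \<union> (?Z #> w)"
  proof -
    have "w = \<one> \<otimes> w" using assms(2) by simp
    thus ?thesis using generate.incl[of z "{z}"] Z.one_closed unfolding r_coset_def by blast
  qed
  ultimately show ?thesis using generate_subgroup_incl assms(5) by blast
qed

text \<open>With \<open>e\<close> as the only involution, two commuting elements \<open>u\<close>, \<open>v\<close> of square \<open>e\<close> satisfy
  \<open>(uv)\<^sup>2 = 1\<close>, whence \<open>u \<in> {v\<^sup>-\<^sup>1, ev\<^sup>-\<^sup>1}\<close>; so \<open>K \<inter> \<langle>z\<rangle>\<close> has at most four elements. The rest of \<open>K\<close>
  lies in the single coset \<open>\<langle>z\<rangle>w\<close>, and right division by one of its elements maps it injectively into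
  \<open>K \<inter> \<langle>z\<rangle>\<close>.\<close>

lemma card_dicyclic_exponent_four:
  assumes zw: "z \<in> carrier G" "w \<in> carrier G" "inv w \<otimes> z \<otimes> w = inv z"
      "w \<otimes> w \<in> generate G {z}"
    and e: "e \<otimes> e = \<one>" "\<And>g. g \<in> carrier G \<Longrightarrow> g \<otimes> g = \<one> \<Longrightarrow> g \<in> {\<one>, e}"
    and K: "subgroup K G" "K \<subseteq> generate G {z, w}"
    and sq: "\<And>u. u \<in> K \<Longrightarrow> u \<in> generate G {z} \<Longrightarrow> u \<otimes> u \<in> {\<one>, e}"
  shows "card K \<le> 8"
proof -
  let ?Z = "generate G {z}"
  interpret Z: subgroup ?Z G using zw(1) by (intro generate_is_subgroup) auto
  interpret K: subgroup K G by fact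
  have "\<exists>v. K \<inter> ?Z \<subseteq> {\<one>, e, inv v, e \<otimes> inv v}"
  proof (cases "\<exists>v \<in> K \<inter> ?Z. v \<otimes> v = e")
    case True
    then obtain v where v: "v \<in> K" "v \<in> ?Z" "v \<otimes> v = e" by blast
    have "u \<in> {\<one>, e, inv v, e \<otimes> inv v}" if u: "u \<in> K" "u \<in> ?Z" for u
    proof (cases "u \<otimes> u = \<one>")
      case True
      thus ?thesis using e(2)[of u] u by auto
    next
      case False
      have vu: "v \<otimes> u = u \<otimes> v" using generate_singleton_commute[OF zw(1)] u v by blast
      have "(u \<otimes> v) \<otimes> (u \<otimes> v) = u \<otimes> (v \<otimes> u) \<otimes> v"
        using u v by (simp add: m_assoc)
      also have "\<dots> = (u \<otimes> u) \<otimes> (v \<otimes> v)" unfolding vu using u v(1,2) by (simp add: m_assoc)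
      also have "\<dots> = \<one>" using sq[OF u] False v e by simp
      finally have "u \<otimes> v \<in> {\<one>, e}" using u v by (intro e(2)) auto
      moreover have "u = (u \<otimes> v) \<otimes> inv v" using u v by (simp add: m_assoc)
      ultimately show ?thesis using v by auto
    qed
    thus ?thesis by blast
  next
    case False
    hence "u \<in> {\<one>, e}" if "u \<in> K" "u \<in> ?Z" for u
      using sq[OF that] that by (intro e(2)) auto
    thus ?thesis by blast
  qed
  then obtain v where "K \<inter> ?Z \<subseteq> {\<one>, e, inv v, e \<otimes> inv v}" by blast
  hence fin: "finite (K \<inter> ?Z)" and "card (K \<inter> ?Z) \<le> card {\<one>, e, inv v, e \<otimes> inv v}"
    by (auto intro: finite_subset card_mono)
  moreover have "card {\<one>, e, inv v, e \<otimes> inv v} \<le> 4"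
    by (simp add: card_insert_if)
  ultimately have 4: "card (K \<inter> ?Z) \<le> 4" by linarith
  have "card (K - ?Z) \<le> card (K \<inter> ?Z)"
  proof (cases "K - ?Z = {}")
    case False
    then obtain g0 where g0: "g0 \<in> K" "g0 \<notin> ?Z" by blast
    have cs: "\<exists>u\<in>?Z. g = u \<otimes> w" if "g \<in> K" "g \<notin> ?Z" for g
      using dicyclic_cases[OF zw, of g] that K(2) by (auto simp: r_coset_def)
    obtain u0 where u0: "u0 \<in> ?Z" "g0 = u0 \<otimes> w" using cs g0 by blast
    show ?thesis
    proof (rule card_inj_on_le[of "\<lambda>g. g \<otimes> inv g0"])
      show "inj_on (\<lambda>g. g \<otimes> inv g0) (K - ?Z)"
        using g0 by (intro inj_onI) simp
      show "(\<lambda>g. g \<otimes> inv g0) ` (K - ?Z) \<subseteq> K \<inter> ?Z"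
      proof safe
        fix g assume g: "g \<in> K" "g \<notin> ?Z"
        obtain u where u: "u \<in> ?Z" "g = u \<otimes> w" using cs g by blast
        have "g \<otimes> inv g0 = u \<otimes> (w \<otimes> inv w) \<otimes> inv u0"
          using u u0 zw(2) by (simp only: inv_mult_group m_assoc m_closed inv_closed Z.mem_carrier)
        also have "\<dots> = u \<otimes> inv u0" using u zw(2) by simp
        also have "\<dots> \<in> ?Z" using u u0 by simp
        finally show "g \<otimes> inv g0 \<in> ?Z" .
        show "g \<otimes> inv g0 \<in> K" using g g0 by simp
      qed
    qed (rule fin)
  next
    case True
    show ?thesis unfolding True by simp
  qed
  moreover have "card K \<le> card (K \<inter> ?Z) + card (K - ?Z)"
    using card_Un_le[of "K \<inter> ?Z" "K - ?Z"] by (simp add: Un_commute Un_Diff_Int)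
  ultimately show ?thesis using 4 by linarith
qed

end

section \<open>Arithmetic of two-by-two matrices\<close>

lemma two_neq_zero_mod_ring:
  assumes "CARD('p::prime_card) \<ge> 5"
  shows "(2 :: 'p mod_ring) \<noteq> 0"
proof
  assume "(2 :: 'p mod_ring) = 0"
  hence "(of_nat 2 :: 'p mod_ring) = 0" by simp
  hence "CARD('p) dvd 2" by (rule of_nat_0_mod_ring_dvd)
  thus False using assms by (auto dest: dvd_imp_le)
qed

definition mat2 :: "'a \<Rightarrow> 'a \<Rightarrow> 'a \<Rightarrow> 'a \<Rightarrow> 'a::comm_ring_1 ^ 2 ^ 2" where
  "mat2 a b c d = vector [vector [a, b], vector [c, d]]"

lemma mat2_nth [simp]:
  "mat2 a b c d $ 1 $ 1 = a" "mat2 a b c d $ 1 $ 2 = b"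
  "mat2 a b c d $ 2 $ 1 = c" "mat2 a b c d $ 2 $ 2 = d"
  by (simp_all add: mat2_def)

lemma mat2_eq_iff [simp]:
  "mat2 a b c d = mat2 a' b' c' d' \<longleftrightarrow> a = a' \<and> b = b' \<and> c = c' \<and> d = d'"
  by (auto simp: vec_eq_iff forall_2)

lemma mat2_cases: obtains a b c d where "A = mat2 a b c d"
proof
  show "A = mat2 (A $ 1 $ 1) (A $ 1 $ 2) (A $ 2 $ 1) (A $ 2 $ 2)"
    by (simp add: vec_eq_iff forall_2)
qed

lemma mat2_mult:
  "mat2 a b c d ** mat2 a' b' c' d' =
     mat2 (a * a' + b * c') (a * b' + b * d') (c * a' + d * c') (c * b' + d * d')"
  by (simp add: vec_eq_iff forall_2 matrix_matrix_mult_def sum_2)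

lemma one_mat2: "mat 1 = mat2 1 0 0 1"
  by (simp add: vec_eq_iff forall_2 mat_def)

lemma uminus_mat2: "- mat2 a b c d = mat2 (- a) (- b) (- c) (- d)"
  by (simp add: vec_eq_iff forall_2)

lemma mat2_in_SL2 [simp]: "mat2 a b c d \<in> carrier SL2 \<longleftrightarrow> a * d - b * c = 1"
  by (simp add: SL2_def det_2)

lemma mult_SL2: "A \<otimes>\<^bsub>SL2\<^esub> B = A ** B"
  by (simp add: SL2_def)

lemma one_SL2: "\<one>\<^bsub>SL2\<^esub> = mat 1"
  by (simp add: SL2_def)

interpretation SL2: group "SL2 :: ('p::prime_card mod_ring ^ 2 ^ 2) monoid"
  by (rule group_SL2)

lemma inv_mat2:
  assumes "a * d - b * c = 1"
  shows "inv\<^bsub>SL2\<^esub> (mat2 a b c d) = mat2 d (- b) (- c) a"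
  using assms
  by (intro SL2.inv_equality) (simp_all add: mult_SL2 one_SL2 mat2_mult one_mat2 algebra_simps)

section \<open>Centralizers and normal subsets of the special linear group\<close>

lemma upper_transvection_conj:
  "inv\<^bsub>SL2\<^esub> (mat2 1 t 0 1) \<otimes>\<^bsub>SL2\<^esub> mat2 a b c d \<otimes>\<^bsub>SL2\<^esub> mat2 1 t 0 1 =
     mat2 (a - t * c) (b + t * (a - d) - t * t * c) c (d + t * c)"
  by (simp add: inv_mat2 mult_SL2 mat2_mult algebra_simps)

lemma lower_transvection_conj:
  "inv\<^bsub>SL2\<^esub> (mat2 1 0 t 1) \<otimes>\<^bsub>SL2\<^esub> mat2 a b c d \<otimes>\<^bsub>SL2\<^esub> mat2 1 0 t 1 =
     mat2 (a + t * b) b (c - t * (a - d) - t * t * b) (d - t * b)"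
  by (simp add: inv_mat2 mult_SL2 mat2_mult algebra_simps)

text \<open>Adding the determinant to the upper left entry of \<open>u\<^sup>2\<close> gives \<open>a(a + d) = 2\<close>, so the trace is nonzero;
  the off-diagonal entries of \<open>u\<^sup>2\<close> are multiples of the trace and must vanish in \<open>u\<close> itself.\<close>

lemma square_one_SL2:
  fixes u :: "'p::prime_card mod_ring ^ 2 ^ 2"
  assumes "(2 :: 'p mod_ring) \<noteq> 0" "u \<in> carrier SL2" "u \<otimes>\<^bsub>SL2\<^esub> u = \<one>\<^bsub>SL2\<^esub>"
  shows "u \<in> {mat 1, - mat 1}"
proof -
  obtain a b c d where u: "u = mat2 a b c d" by (rule mat2_cases)
  have eqs: "a * a + b * c = 1" "a * b + b * d = 0" "c * a + d * c = 0" "a * d - b * c = 1"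
    using assms by (simp_all add: u mult_SL2 one_SL2 one_mat2 mat2_mult)
  have "a * (a + d) = (a * a + b * c) + (a * d - b * c)" by (simp add: algebra_simps)
  hence "a * (a + d) = 2" using eqs(1,4) by simp
  hence "a + d \<noteq> 0" using assms(1) by auto
  moreover have "b * (a + d) = 0" "c * (a + d) = 0"
    using eqs(2,3) by (simp_all add: algebra_simps)
  ultimately have bc: "b = 0" "c = 0" by auto
  have "(a - 1) * (a + 1) = 0" using eqs(1) bc by (simp add: algebra_simps)
  hence "a = 1 \<or> a = -1" by (auto simp: eq_neg_iff_add_eq_0)
  moreover have "a * d = 1" using eqs(4) bc by simp
  ultimately show ?thesis by (auto simp: u bc one_mat2 uminus_mat2 minus_equation_iff)
qed

lemma scalar_SL2:
  assumes "mat2 a 0 0 a \<in> carrier SL2"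
  shows "mat2 a 0 0 a \<in> {mat 1, - mat 1}"
proof -
  have "(a - 1) * (a + 1) = 0" using assms by (simp add: algebra_simps)
  hence "a = 1 \<or> a = -1" by (auto simp: eq_neg_iff_add_eq_0)
  thus ?thesis by (auto simp: one_mat2 uminus_mat2)
qed

lemma minus_one_mult_SL2:
  "- mat 1 \<otimes>\<^bsub>SL2\<^esub> u = - u" "u \<otimes>\<^bsub>SL2\<^esub> - mat 1 = - u"
proof -
  obtain a b c d where u: "u = mat2 a b c d" by (rule mat2_cases)
  show "- mat 1 \<otimes>\<^bsub>SL2\<^esub> u = - u" "u \<otimes>\<^bsub>SL2\<^esub> - mat 1 = - u"
    by (simp_all add: u mult_SL2 one_mat2 uminus_mat2 mat2_mult)
qed

lemma minus_one_SL2: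
  "- mat 1 \<in> carrier SL2" "- mat 1 \<otimes>\<^bsub>SL2\<^esub> - mat 1 = \<one>\<^bsub>SL2\<^esub>"
  by (simp_all add: one_mat2 uminus_mat2 mult_SL2 one_SL2 mat2_mult)

lemma one_neq_minus_one_SL2:
  assumes "(2 :: 'p::prime_card mod_ring) \<noteq> 0"
  shows "mat 1 \<noteq> (- mat 1 :: 'p mod_ring ^ 2 ^ 2)"
proof
  assume "mat 1 = (- mat 1 :: 'p mod_ring ^ 2 ^ 2)"
  hence "(1 :: 'p mod_ring) = - 1" by (simp add: one_mat2 uminus_mat2)
  hence "(1 :: 'p mod_ring) + 1 = 0" by (simp only: eq_neg_iff_add_eq_0)
  thus False using assms by (simp only: one_add_one)
qed

text \<open>Two vectors proportional to the same nonzero vector \<open>(x, y, t)\<close> are proportional to each other; the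
  conclusion is one of the three minors that express this.\<close>

lemma proportional_trans:
  fixes x y t :: "'a::idom"
  assumes "x \<noteq> 0 \<or> y \<noteq> 0 \<or> t \<noteq> 0"
    and "x * y1 = x1 * y" "x * y2 = x2 * y" "x * t1 = x1 * t" "y * t1 = y1 * t"
  shows "x1 * y2 = x2 * y1"
proof -
  have "x * (x1 * y2) = x * (x2 * y1)"
  proof -
    have "x * (x1 * y2) = x1 * (x * y2)" by (simp add: mult_ac)
    also have "\<dots> = x2 * (x1 * y)" unfolding assms(3) by (simp add: mult_ac)
    also have "\<dots> = x * (x2 * y1)" unfolding assms(2)[symmetric] by (simp add: mult_ac)
    finally show ?thesis .
  qed
  moreover have "y * (x1 * y2) = y * (x2 * y1)"
  proof -
    have "y * (x1 * y2) = (x1 * y) * y2" by (simp add: mult_ac)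
    also have "\<dots> = y1 * (x * y2)" unfolding assms(2)[symmetric] by (simp add: mult_ac)
    also have "\<dots> = y * (x2 * y1)" unfolding assms(3) by (simp add: mult_ac)
    finally show ?thesis .
  qed
  moreover have "t * (x1 * y2) = t * (x2 * y1)"
  proof -
    have "t * (x1 * y2) = (x1 * t) * y2" by (simp add: mult_ac)
    also have "\<dots> = t1 * (x * y2)" unfolding assms(4)[symmetric] by (simp add: mult_ac)
    also have "\<dots> = x2 * (y * t1)" unfolding assms(3) by (simp add: mult_ac)
    also have "\<dots> = t * (x2 * y1)" unfolding assms(5) by (simp add: mult_ac)
    finally show ?thesis .
  qed
  ultimately show ?thesis using assms(1) by auto
qed

text \<open>Matrices commute if and only if their parts \<open>(b, c, a - d)\<close>, which describe them modulo scalars, are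
  proportional. For a noncentral matrix this vector is nonzero.\<close>

lemma centralizer_commutative_SL2:
  assumes "u \<in> carrier SL2" "u \<notin> {mat 1, - mat 1}"
    and "g \<in> centralizer SL2 u" "h \<in> centralizer SL2 u"
  shows "g \<otimes>\<^bsub>SL2\<^esub> h = h \<otimes>\<^bsub>SL2\<^esub> g"
proof -
  obtain a b c d where u: "u = mat2 a b c d" by (rule mat2_cases)
  obtain a1 b1 c1 d1 where g: "g = mat2 a1 b1 c1 d1" by (rule mat2_cases)
  obtain a2 b2 c2 d2 where h: "h = mat2 a2 b2 c2 d2" by (rule mat2_cases)
  have par: "b * c' = b' * c" "b * (a' - d') = b' * (a - d)" "c * (a' - d') = c' * (a - d)"
    if "mat2 a' b' c' d' \<in> centralizer SL2 u" for a' b' c' d'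
  proof -
    have "a' * a + b' * c = a * a' + b * c'" "a' * b + b' * d = a * b' + b * d'"
      "c' * a + d' * c = c * a' + d * c'"
      using that by (simp_all add: centralizer_def u mult_SL2 mat2_mult)
    thus "b * c' = b' * c" "b * (a' - d') = b' * (a - d)" "c * (a' - d') = c' * (a - d)"
      by (simp_all add: algebra_simps)
  qed
  note pg = par[OF assms(3)[unfolded g]] and ph = par[OF assms(4)[unfolded h]]
  have nz: "b \<noteq> 0 \<or> c \<noteq> 0 \<or> a - d \<noteq> 0"
    using scalar_SL2[of a] assms(1,2) by (auto simp: u)
  have "b1 * c2 = b2 * c1"
    by (rule proportional_trans[OF nz pg(1) ph(1) pg(2,3)])
  moreover have "b1 * (a2 - d2) = b2 * (a1 - d1)"
  proof (rule proportional_trans[OF _ pg(2) ph(2) pg(1)])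
    show "b \<noteq> 0 \<or> a - d \<noteq> 0 \<or> c \<noteq> 0" using nz by blast
    show "(a - d) * c1 = (a1 - d1) * c" using pg(3) by (simp only: mult.commute)
  qed
  moreover have "c1 * (a2 - d2) = c2 * (a1 - d1)"
  proof (rule proportional_trans[OF _ pg(3) ph(3)])
    show "c \<noteq> 0 \<or> a - d \<noteq> 0 \<or> b \<noteq> 0" using nz by blast
    show "c * b1 = c1 * b" using pg(1) by (simp only: mult.commute)
    show "(a - d) * b1 = (a1 - d1) * b" using pg(2) by (simp only: mult.commute)
  qed
  ultimately show ?thesis by (simp add: g h mult_SL2 mat2_mult algebra_simps)
qed

lemma centralizer_eq_SL2:
  assumes "u \<in> carrier SL2" "u \<notin> {mat 1, - mat 1}"
    and "v \<in> carrier SL2" "v \<notin> {mat 1, - mat 1}" "u \<otimes>\<^bsub>SL2\<^esub> v = v \<otimes>\<^bsub>SL2\<^esub> u"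
  shows "centralizer SL2 u = centralizer SL2 v"
proof -
  have sub: "centralizer SL2 a \<subseteq> centralizer SL2 b"
    if "a \<in> carrier SL2" "a \<notin> {mat 1, - mat 1}" "b \<in> carrier SL2"
      "b \<otimes>\<^bsub>SL2\<^esub> a = a \<otimes>\<^bsub>SL2\<^esub> b" for a b
    using centralizer_commutative_SL2[OF that(1,2), of _ b] that(3,4)
    by (auto simp: centralizer_def)
  show ?thesis
    using sub[OF assms(1-3) assms(5)[symmetric]] sub[OF assms(3,4,1,5)] by blast
qed

text \<open>Conjugation by the lower transvection with entry \<open>t\<close> changes the lower left entry into the polynomial
  \<open>c - t(a - d) - t\<^sup>2b\<close>. If it vanishes at \<open>t = 0, 1, -1\<close>, then \<open>b = c = 0\<close> and \<open>a = d\<close>.\<close>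

lemma normal_noncentral_has_lower_left_SL2:
  fixes u :: "'p::prime_card mod_ring ^ 2 ^ 2"
  assumes "(2 :: 'p mod_ring) \<noteq> 0"
    and cl: "\<And>g v. g \<in> carrier SL2 \<Longrightarrow> v \<in> N \<Longrightarrow> inv\<^bsub>SL2\<^esub> g \<otimes>\<^bsub>SL2\<^esub> v \<otimes>\<^bsub>SL2\<^esub> g \<in> N"
    and u: "u \<in> N" "u \<in> carrier SL2" "u \<notin> {mat 1, - mat 1}"
  obtains a b c d where "mat2 a b c d \<in> N" "c \<noteq> 0"
proof -
  obtain a b c d where u': "u = mat2 a b c d" by (rule mat2_cases)
  have N: "mat2 (a + t * b) b (c - t * (a - d) - t * t * b) (d - t * b) \<in> N" for t
    using cl[of "mat2 1 0 t 1" u] u(1) unfolding u' lower_transvection_conj by simp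
  have "\<exists>t. c - t * (a - d) - t * t * b \<noteq> 0"
  proof (rule ccontr)
    assume "\<nexists>t. c - t * (a - d) - t * t * b \<noteq> 0"
    hence z: "c - t * (a - d) - t * t * b = 0" for t by blast
    have c: "c = 0" using z[of 0] by simp
    have z1: "0 - 1 * (a - d) - 1 * 1 * b = 0" and z2: "0 - (- 1) * (a - d) - (- 1) * (- 1) * b = 0"
      using z[of 1] z[of "-1"] unfolding c by blast+
    have "2 * b = - (0 - 1 * (a - d) - 1 * 1 * b) - (0 - (- 1) * (a - d) - (- 1) * (- 1) * b)"
      "2 * (a - d) = (0 - (- 1) * (a - d) - (- 1) * (- 1) * b) - (0 - 1 * (a - d) - 1 * 1 * b)"
      by (simp_all add: algebra_simps)
    hence "2 * b = 0" "2 * (a - d) = 0" unfolding z1 z2 by simp_all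
    hence "b = 0" "a = d" using assms(1) by auto
    thus False using scalar_SL2[of a] u c by (auto simp: u')
  qed
  then obtain t where "c - t * (a - d) - t * t * b \<noteq> 0" by blast
  thus thesis by (rule that[OF N])
qed

text \<open>With \<open>c \<noteq> 0\<close>, the \<open>p\<close> conjugates by upper transvections are distinct, since their upper left entries
  \<open>a - tc\<close> are, and all of them have lower left entry \<open>c\<close>. Their negatives have lower left entry \<open>-c\<close>
  and are therefore \<open>p\<close> further elements.\<close>

lemma card_normal_noncentral_SL2:
  fixes u :: "'p::prime_card mod_ring ^ 2 ^ 2"
  assumes 2: "(2 :: 'p mod_ring) \<noteq> 0"
    and cl: "\<And>g v. g \<in> carrier SL2 \<Longrightarrow> v \<in> N \<Longrightarrow> inv\<^bsub>SL2\<^esub> g \<otimes>\<^bsub>SL2\<^esub> v \<otimes>\<^bsub>SL2\<^esub> g \<in> N"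
    and neg: "\<And>v. v \<in> N \<Longrightarrow> - v \<in> N"
    and u: "u \<in> N" "u \<in> carrier SL2" "u \<notin> {mat 1, - mat 1}"
  shows "2 * CARD('p) \<le> card N"
proof -
  obtain a b c d where v: "mat2 a b c d \<in> N" "c \<noteq> 0"
    using normal_noncentral_has_lower_left_SL2[OF 2 cl u] by blast
  define f where "f t = mat2 (a - t * c) (b + t * (a - d) - t * t * c) c (d + t * c)" for t
  have f: "f t \<in> N" for t
    using cl[of "mat2 1 t 0 1", OF _ v(1)] unfolding upper_transvection_conj f_def by simp
  have inj: "inj f" using v(2) by (auto intro!: injI simp: f_def)
  have "c \<noteq> - c"
  proof
    assume "c = - c"
    hence "c + c = 0" by (simp add: eq_neg_iff_add_eq_0)
    hence "2 * c = 0" by (simp only: mult_2)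
    thus False using 2 v(2) by simp
  qed
  hence disj: "range f \<inter> range (\<lambda>t. - f t) = {}" by (auto simp: f_def uminus_mat2)
  have "inj (\<lambda>t. - f t)" using inj by (auto simp: inj_def)
  hence "card (range f \<union> range (\<lambda>t. - f t)) = 2 * CARD('p)"
    using disj inj by (subst card_Un_disjoint) (auto simp: card_image)
  moreover have "range f \<union> range (\<lambda>t. - f t) \<subseteq> N" using f neg by auto
  ultimately show ?thesis by (metis card_mono finite)
qed

text \<open>If \<open>c \<noteq> 0\<close>, a matrix and its conjugate by an upper transvection do not commute: the lower left
  entries of the two products differ by \<open>2c\<^sup>2\<close>.\<close>

lemma commutative_normal_central_SL2:
  fixes u :: "'p::prime_card mod_ring ^ 2 ^ 2"
  assumes 2: "(2 :: 'p mod_ring) \<noteq> 0"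
    and cl: "\<And>g v. g \<in> carrier SL2 \<Longrightarrow> v \<in> N \<Longrightarrow> inv\<^bsub>SL2\<^esub> g \<otimes>\<^bsub>SL2\<^esub> v \<otimes>\<^bsub>SL2\<^esub> g \<in> N"
    and comm: "\<And>v v'. v \<in> N \<Longrightarrow> v' \<in> N \<Longrightarrow> v \<otimes>\<^bsub>SL2\<^esub> v' = v' \<otimes>\<^bsub>SL2\<^esub> v"
    and u: "u \<in> N" "u \<in> carrier SL2"
  shows "u \<in> {mat 1, - mat 1}"
proof (rule ccontr)
  assume "u \<notin> {mat 1, - mat 1}"
  then obtain a b c d where v: "mat2 a b c d \<in> N" "c \<noteq> 0"
    using normal_noncentral_has_lower_left_SL2[OF 2 cl u] by blast
  have "mat2 (a - c) (b + (a - d) - c) c (d + c) \<in> N"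
    using cl[of "mat2 1 1 0 1", OF _ v(1)] unfolding upper_transvection_conj by simp
  from comm[OF v(1) this] have "c * (a - c) + d * c = c * a + (d + c) * c"
    unfolding mult_SL2 mat2_mult mat2_eq_iff by blast
  moreover have "2 * (c * c) = (c * a + (d + c) * c) - (c * (a - c) + d * c)"
    by (simp add: algebra_simps)
  ultimately have "2 * (c * c) = 0" by simp
  thus False using 2 v(2) by simp
qed

lemma subgroup_center_SL2: "subgroup {mat 1, - mat 1} SL2"
proof (rule SL2.subgroupI)
  have "inv\<^bsub>SL2\<^esub> (- mat 1) = - mat 1"
    by (intro SL2.inv_equality minus_one_SL2)
  thus "inv\<^bsub>SL2\<^esub> a \<in> {mat 1, - mat 1}" if "a \<in> {mat 1, - mat 1}" for a
    using that SL2.inv_one unfolding one_SL2 by auto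
  show "a \<otimes>\<^bsub>SL2\<^esub> b \<in> {mat 1, - mat 1}" if "a \<in> {mat 1, - mat 1}" "b \<in> {mat 1, - mat 1}" for a b
    using that by (auto simp: mult_SL2 one_mat2 uminus_mat2 mat2_mult)
  show "{mat 1, - mat 1} \<subseteq> carrier SL2"
    using minus_one_SL2(1) SL2.one_closed unfolding one_SL2 by blast
qed simp

text \<open>Central elements are fixed by conjugation, and conjugation is injective.\<close>

lemma conj_eq_central_iff_SL2:
  assumes "x \<in> carrier SL2" "u \<in> carrier SL2" "e \<in> {mat 1, - mat 1}"
  shows "inv\<^bsub>SL2\<^esub> x \<otimes>\<^bsub>SL2\<^esub> u \<otimes>\<^bsub>SL2\<^esub> x = e \<longleftrightarrow> u = e"
proof -
  have e: "e \<in> carrier SL2"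
    using assms(3) subgroup.subset[OF subgroup_center_SL2] by blast
  have "x \<otimes>\<^bsub>SL2\<^esub> e = e \<otimes>\<^bsub>SL2\<^esub> x"
  proof (cases "e = - mat 1")
    case True
    thus ?thesis by (simp add: minus_one_mult_SL2)
  next
    case False
    hence "e = mat 1" using assms(3) by blast
    thus ?thesis by (simp add: mult_SL2)
  qed
  thus ?thesis using assms(1,2) e by (simp add: SL2.conj_eq_iff)
qed

text \<open>If \<open>u\<close> were noncentral, then \<open>u\<close>, its conjugate by \<open>x\<close> and \<open>z\<close> would be commuting noncentral elements
  and have a common centralizer \<open>T\<close>. Conjugation by \<open>x\<close> maps the centralizer of \<open>u\<close> to that of its
  conjugate, and conjugation by \<open>w\<close> maps the centralizer of \<open>z\<close> to that of \<open>z\<^sup>-\<^sup>1\<close>; both are \<open>T\<close> again.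
  So \<open>T\<close> is normal and commutative, which forces \<open>z\<close> to be central.\<close>

lemma conj_cyclic_part_central_SL2:
  fixes z w x u :: "'p::prime_card mod_ring ^ 2 ^ 2"
  assumes 2: "(2 :: 'p mod_ring) \<noteq> 0"
    and zwx: "z \<in> carrier SL2" "w \<in> carrier SL2" "x \<in> carrier SL2"
    and inv: "inv\<^bsub>SL2\<^esub> w \<otimes>\<^bsub>SL2\<^esub> z \<otimes>\<^bsub>SL2\<^esub> w = inv\<^bsub>SL2\<^esub> z"
    and gen: "generate SL2 {z, w, x} = carrier SL2"
    and u: "u \<in> generate SL2 {z}" "inv\<^bsub>SL2\<^esub> x \<otimes>\<^bsub>SL2\<^esub> u \<otimes>\<^bsub>SL2\<^esub> x \<in> generate SL2 {z}"
  shows "u \<in> {mat 1, - mat 1}"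
proof (rule ccontr)
  assume nc: "u \<notin> {mat 1, - mat 1}"
  let ?u' = "inv\<^bsub>SL2\<^esub> x \<otimes>\<^bsub>SL2\<^esub> u \<otimes>\<^bsub>SL2\<^esub> x"
  have uc: "u \<in> carrier SL2" using u(1) zwx(1) SL2.generate_in_carrier[of "{z}"] by auto
  have nc': "?u' \<notin> {mat 1, - mat 1}"
    using conj_eq_central_iff_SL2[OF zwx(3) uc] nc by blast
  have u'c: "?u' \<in> carrier SL2" using uc zwx by simp
  have znc: "z \<notin> {mat 1, - mat 1}"
  proof
    assume "z \<in> {mat 1, - mat 1}"
    hence "generate SL2 {z} \<subseteq> {mat 1, - mat 1}"
      by (intro SL2.generate_subgroup_incl[OF _ subgroup_center_SL2]) simp
    thus False using u(1) nc by blast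
  qed
  have comm_z: "g \<otimes>\<^bsub>SL2\<^esub> z = z \<otimes>\<^bsub>SL2\<^esub> g" if "g \<in> generate SL2 {z}" for g
    using that zwx(1) by (intro SL2.generate_singleton_commute) (auto intro: generate.incl)
  define T where "T = centralizer SL2 z"
  have T: "centralizer SL2 u = T" "centralizer SL2 ?u' = T"
    unfolding T_def
    using centralizer_eq_SL2[OF uc nc zwx(1) znc comm_z[OF u(1)]]
      centralizer_eq_SL2[OF u'c nc' zwx(1) znc comm_z[OF u(2)]] by auto
  have zT: "z \<in> T" unfolding T_def centralizer_def using zwx(1) by simp
  have subT: "subgroup T SL2" unfolding T_def by (rule SL2.subgroup_centralizer[OF zwx(1)])
  interpret T: subgroup T SL2 by (rule subT)
  have "inv\<^bsub>SL2\<^esub> s \<otimes>\<^bsub>SL2\<^esub> v \<otimes>\<^bsub>SL2\<^esub> s \<in> T" if s: "s \<in> {z, w, x}" and v: "v \<in> T" for s v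
  proof -
    consider "s = z" | "s = w" | "s = x" using s by blast
    thus ?thesis
    proof cases
      case 1
      show ?thesis unfolding 1 by (intro T.m_closed T.m_inv_closed v zT)
    next
      case 2
      let ?g = "inv\<^bsub>SL2\<^esub> w \<otimes>\<^bsub>SL2\<^esub> v \<otimes>\<^bsub>SL2\<^esub> w"
      have "?g \<in> centralizer SL2 (inv\<^bsub>SL2\<^esub> z)"
        using SL2.centralizer_conj[OF zwx(2,1), of v] v unfolding T_def inv by blast
      hence g: "?g \<in> carrier SL2" "inv\<^bsub>SL2\<^esub> z \<in> centralizer SL2 ?g"
        using zwx(1) by (auto simp: centralizer_def)
      have "inv\<^bsub>SL2\<^esub> (inv\<^bsub>SL2\<^esub> z) \<in> centralizer SL2 ?g"
        by (intro subgroup.m_inv_closed[OF SL2.subgroup_centralizer] g)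
      hence "z \<in> centralizer SL2 ?g" using zwx(1) by simp
      hence "?g \<in> T" using g(1) unfolding T_def centralizer_def by simp
      thus ?thesis using 2 by simp
    next
      case 3
      thus ?thesis using SL2.centralizer_conj[OF zwx(3) uc, of v] v unfolding T by blast
    qed
  qed
  hence "inv\<^bsub>SL2\<^esub> g \<otimes>\<^bsub>SL2\<^esub> v \<otimes>\<^bsub>SL2\<^esub> g \<in> T" if "g \<in> carrier SL2" "v \<in> T" for g v
    using SL2.conj_closed_generate[of T "{z, w, x}" g v] that zwx gen T.subset by auto
  moreover have "v \<otimes>\<^bsub>SL2\<^esub> v' = v' \<otimes>\<^bsub>SL2\<^esub> v" if "v \<in> T" "v' \<in> T" for v v'
    using that centralizer_commutative_SL2[OF zwx(1) znc] unfolding T_def by blast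
  ultimately have "z \<in> {mat 1, - mat 1}"
    by (intro commutative_normal_central_SL2[OF 2 _ _ zT zwx(1)])
  thus False using znc by blast
qed

text \<open>Let \<open>u \<in> \<langle>z\<rangle>\<close> lie in the intersection. Its conjugate lies in \<open>\<langle>z\<rangle>\<close>, so that \<open>u\<close> is central, or in
  \<open>\<langle>z\<rangle>w\<close>, so that the conjugate and hence \<open>u\<close> itself have square \<open>-I\<close>. In both cases \<open>u\<^sup>2 = \<plusminus>I\<close>.\<close>

lemma card_conj_meet_le_8_SL2:
  fixes z w x :: "'p::prime_card mod_ring ^ 2 ^ 2"
  assumes 2: "(2 :: 'p mod_ring) \<noteq> 0"
    and zwx: "z \<in> carrier SL2" "w \<in> carrier SL2" "x \<in> carrier SL2"
    and inv: "inv\<^bsub>SL2\<^esub> w \<otimes>\<^bsub>SL2\<^esub> z \<otimes>\<^bsub>SL2\<^esub> w = inv\<^bsub>SL2\<^esub> z"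
    and w2: "w \<otimes>\<^bsub>SL2\<^esub> w = - mat 1" "- mat 1 \<in> generate SL2 {z}"
    and gen: "generate SL2 {z, w, x} = carrier SL2"
  shows "card (conj_meet SL2 (generate SL2 {z, w}) x) \<le> 8"
proof (rule SL2.card_dicyclic_exponent_four[OF zwx(1,2) inv])
  let ?H = "generate SL2 {z, w}" and ?Z = "generate SL2 {z}"
  have H: "subgroup ?H SL2" using zwx by (intro SL2.generate_is_subgroup) auto
  show "w \<otimes>\<^bsub>SL2\<^esub> w \<in> ?Z" using w2 by simp
  show "- mat 1 \<otimes>\<^bsub>SL2\<^esub> - mat 1 = \<one>\<^bsub>SL2\<^esub>" by (rule minus_one_SL2)
  show "g \<in> {\<one>\<^bsub>SL2\<^esub>, - mat 1}"
    if "g \<in> carrier SL2" "g \<otimes>\<^bsub>SL2\<^esub> g = \<one>\<^bsub>SL2\<^esub>" for g :: "'p mod_ring ^ 2 ^ 2"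
    using square_one_SL2[OF 2 that] by (simp add: one_SL2)
  show "subgroup (conj_meet SL2 ?H x) SL2" by (rule SL2.subgroup_conj_meet[OF H zwx(3)])
  show "conj_meet SL2 ?H x \<subseteq> ?H" by (auto simp: conj_meet_def)
  fix u assume u: "u \<in> conj_meet SL2 ?H x" "u \<in> ?Z"
  let ?u' = "inv\<^bsub>SL2\<^esub> x \<otimes>\<^bsub>SL2\<^esub> u \<otimes>\<^bsub>SL2\<^esub> x"
  have uc: "u \<in> carrier SL2" using u(2) zwx(1) SL2.generate_in_carrier[of "{z}"] by auto
  have "?u' \<in> ?H" using u(1) by (simp add: conj_meet_def)
  hence "?u' \<in> ?Z \<union> (?Z #>\<^bsub>SL2\<^esub> w)"
    using w2 by (intro SL2.dicyclic_cases[OF zwx(1,2) inv]) auto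
  then consider "?u' \<in> ?Z" | v where "v \<in> ?Z" "?u' = v \<otimes>\<^bsub>SL2\<^esub> w"
    by (auto simp: r_coset_def)
  thus "u \<otimes>\<^bsub>SL2\<^esub> u \<in> {\<one>\<^bsub>SL2\<^esub>, - mat 1}"
  proof cases
    case 1
    have "u \<in> {mat 1, - mat 1}"
      by (rule conj_cyclic_part_central_SL2[OF 2 zwx inv gen u(2) 1])
    thus ?thesis
      using subgroup.m_closed[OF subgroup_center_SL2] unfolding one_SL2 by blast
  next
    case (2 v)
    have "inv\<^bsub>SL2\<^esub> x \<otimes>\<^bsub>SL2\<^esub> (u \<otimes>\<^bsub>SL2\<^esub> u) \<otimes>\<^bsub>SL2\<^esub> x = ?u' \<otimes>\<^bsub>SL2\<^esub> ?u'"
      by (rule SL2.conj_mult[OF zwx(3) uc uc])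
    also have "\<dots> = w \<otimes>\<^bsub>SL2\<^esub> w"
      unfolding 2(2) by (rule SL2.dicyclic_square[OF zwx(1,2) inv 2(1)])
    also have "\<dots> = - mat 1" by (rule w2(1))
    finally have "u \<otimes>\<^bsub>SL2\<^esub> u = - mat 1"
      using uc zwx(3) by (subst (asm) conj_eq_central_iff_SL2) auto
    thus ?thesis by simp
  qed
qed

text \<open>A normal subset that is closed under negation and contains a noncentral element has at least
  \<open>2p \<ge> 10\<close> elements.\<close>

lemma small_normal_central_SL2:
  fixes N A :: "('p::prime_card mod_ring ^ 2 ^ 2) set"
  assumes "CARD('p) \<ge> 5" "card N \<le> 8" "subgroup N SL2" "- mat 1 \<in> N"
    and A: "A \<subseteq> carrier SL2" "generate SL2 A = carrier SL2"
    and cl: "\<And>s v. s \<in> A \<Longrightarrow> v \<in> N \<Longrightarrow> inv\<^bsub>SL2\<^esub> s \<otimes>\<^bsub>SL2\<^esub> v \<otimes>\<^bsub>SL2\<^esub> s \<in> N"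
  shows "N \<subseteq> {mat 1, - mat 1}"
proof (rule ccontr)
  interpret N: subgroup N SL2 by fact
  assume "\<not> N \<subseteq> {mat 1, - mat 1}"
  then obtain u where u: "u \<in> N" "u \<notin> {mat 1, - mat 1}" by blast
  have conj: "inv\<^bsub>SL2\<^esub> g \<otimes>\<^bsub>SL2\<^esub> v \<otimes>\<^bsub>SL2\<^esub> g \<in> N" if "g \<in> carrier SL2" "v \<in> N" for g v
    using SL2.conj_closed_generate[of N A g v] that A cl N.subset by simp
  have neg: "- v \<in> N" if "v \<in> N" for v
    using N.m_closed[OF assms(4) that] unfolding minus_one_mult_SL2 .
  have "2 * CARD('p) \<le> card N"
    using card_normal_noncentral_SL2[OF two_neq_zero_mod_ring[OF assms(1)] conj neg u(1) _ u(2)]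
      u(1) by simp
  thus False using assms(1,2) by linarith
qed

section \<open>Growth of the set\<close>

theorem proposition4p3:
  fixes n :: nat
    and z w x :: "'p::prime_card mod_ring ^ 2 ^ 2"
    and H S :: "('p mod_ring ^ 2 ^ 2) set"
  assumes "CARD('p) \<ge> 5"
    and "n \<ge> 1"
    and "z \<in> carrier SL2" and "w \<in> carrier SL2"
    and "H = generate SL2 {z, w}"
    and "double_dihedral H n"
    and "quaternion_relations z w n"
    and "x \<in> carrier SL2"
    and "S = H \<union> {x, inv\<^bsub>SL2\<^esub> x} \<or>
         (x [^]\<^bsub>SL2\<^esub> (2::nat) \<in> H \<and> S = H \<union> ((x <#\<^bsub>SL2\<^esub> H) \<inter> (H #>\<^bsub>SL2\<^esub> x)))"
    and "generate SL2 S = carrier SL2"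
  shows "real (card (S <#>\<^bsub>SL2\<^esub> S <#>\<^bsub>SL2\<^esub> S)) \<ge> real (card S) powr (1 + log 2 3 / 5)"
proof -
  note zc = assms(3) and wc = assms(4) and H_def = assms(5) and xc = assms(8)
  note 2 = two_neq_zero_mod_ring[OF assms(1)]
  have sq: "y [^]\<^bsub>SL2\<^esub> (2::nat) = y \<otimes>\<^bsub>SL2\<^esub> y" if "y \<in> carrier SL2" for y :: "'p mod_ring ^ 2 ^ 2"
    using that by (simp add: numeral_2_eq_2)
  have inv: "inv\<^bsub>SL2\<^esub> w \<otimes>\<^bsub>SL2\<^esub> z \<otimes>\<^bsub>SL2\<^esub> w = inv\<^bsub>SL2\<^esub> z"
    and w2: "w \<otimes>\<^bsub>SL2\<^esub> w = - mat 1" and zn: "z [^]\<^bsub>SL2\<^esub> n = - mat 1"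
    using assms(7) sq[OF wc] by (auto simp: quaternion_relations_def)
  have mZ: "- mat 1 \<in> generate SL2 {z}"
  proof -
    have "- mat 1 = z [^]\<^bsub>SL2\<^esub> int n" unfolding zn[symmetric] by (simp add: int_pow_int)
    thus ?thesis unfolding SL2.generate_pow[OF zc] by blast
  qed
  have sub: "subgroup H SL2" unfolding H_def using zc wc by (intro SL2.generate_is_subgroup) auto
  interpret H: subgroup H SL2 by fact
  have zH: "z \<in> H" and wH: "w \<in> H" unfolding H_def by (auto intro: generate.incl)
  have wnc: "w \<notin> {mat 1, - mat 1}"
  proof
    assume "w \<in> {mat 1, - mat 1}"
    hence "w \<otimes>\<^bsub>SL2\<^esub> w = mat 1"
      by (auto simp: mult_SL2 one_mat2 uminus_mat2 mat2_mult)
    thus False using w2 one_neq_minus_one_SL2[OF 2] by simp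
  qed
  define K where "K = conj_meet SL2 H x"
  have subK: "subgroup K SL2" unfolding K_def by (rule SL2.subgroup_conj_meet[OF sub xc])
  interpret K: subgroup K SL2 by fact
  have KH: "K \<subseteq> H" unfolding K_def conj_meet_def by blast
  have coset: "(x <#\<^bsub>SL2\<^esub> H) \<inter> (H #>\<^bsub>SL2\<^esub> x) = K #>\<^bsub>SL2\<^esub> x"
    unfolding K_def by (rule SL2.coset_meet_eq_conj_meet_coset[OF sub xc])
  have xS: "x \<in> S"
  proof -
    have "x = \<one>\<^bsub>SL2\<^esub> \<otimes>\<^bsub>SL2\<^esub> x" using xc by simp
    hence "x \<in> K #>\<^bsub>SL2\<^esub> x" using K.one_closed unfolding r_coset_def by blast
    thus ?thesis using assms(9) coset by auto
  qed
  have HS: "H \<subseteq> S" using assms(9) by blast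
  \<comment> \<open>In both cases \<open>S\<close> lies in the group generated by \<open>H\<close> and \<open>x\<close>, so it suffices to test normality
      on the generators \<open>z\<close>, \<open>w\<close>, \<open>x\<close>.\<close>
  have gen: "generate SL2 {z, w, x} = carrier SL2"
  proof -
    let ?J = "generate SL2 {z, w, x}"
    have J: "subgroup ?J SL2" using zc wc xc by (intro SL2.generate_is_subgroup) auto
    interpret J: subgroup ?J SL2 by fact
    have xJ: "x \<in> ?J" by (auto intro: generate.incl)
    have HJ: "H \<subseteq> ?J" unfolding H_def
      by (rule SL2.generate_subgroup_incl[OF _ J]) (auto intro: generate.incl)
    have "K #>\<^bsub>SL2\<^esub> x \<subseteq> ?J" using KH HJ xJ unfolding r_coset_def by blast
    hence "S \<subseteq> ?J" using assms(9) coset HJ xJ by auto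
    hence "generate SL2 S \<subseteq> ?J" by (rule SL2.generate_subgroup_incl[OF _ J])
    thus ?thesis using assms(10) J.subset by blast
  qed
  have k8: "card K \<le> 8"
    unfolding K_def H_def
    by (rule card_conj_meet_le_8_SL2[OF 2 zc wc xc inv w2 mZ gen])
  have mK: "- mat 1 \<in> K"
  proof -
    have "- mat 1 \<in> H" using H.m_closed[OF wH wH] unfolding w2 .
    moreover have "inv\<^bsub>SL2\<^esub> x \<otimes>\<^bsub>SL2\<^esub> - mat 1 \<otimes>\<^bsub>SL2\<^esub> x = - mat 1"
      using xc minus_one_SL2(1) by (subst conj_eq_central_iff_SL2) auto
    ultimately show ?thesis unfolding K_def conj_meet_def by simp
  qed
  have cenK: "{mat 1, - mat 1} \<subseteq> K" using mK K.one_closed unfolding one_SL2 by blast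
  have normal_central: "K \<subseteq> {mat 1, - mat 1}"
    if "\<And>s v. s \<in> {z, w, x} \<Longrightarrow> v \<in> K \<Longrightarrow> inv\<^bsub>SL2\<^esub> s \<otimes>\<^bsub>SL2\<^esub> v \<otimes>\<^bsub>SL2\<^esub> s \<in> K"
    using small_normal_central_SL2[OF assms(1) k8 subK mK _ gen that] zc wc xc by auto
  have card_cen: "card {mat 1, - mat 1 :: 'p mod_ring ^ 2 ^ 2} = 2"
    using one_neq_minus_one_SL2[OF 2] by simp
  have k2: "2 \<le> card K" using card_mono[OF _ cenK] card_cen by simp
  have "K \<noteq> H"
  proof
    assume eq: "K = H"
    have "inv\<^bsub>SL2\<^esub> s \<otimes>\<^bsub>SL2\<^esub> v \<otimes>\<^bsub>SL2\<^esub> s \<in> K" if "s \<in> {z, w, x}" "v \<in> K" for s v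
    proof (cases "s = x")
      case True
      thus ?thesis using that(2) eq unfolding K_def conj_meet_def by blast
    next
      case False
      hence "s \<in> H" using that(1) zH wH by blast
      thus ?thesis using that(2) unfolding eq by (intro H.m_closed H.m_inv_closed)
    qed
    hence "K \<subseteq> {mat 1, - mat 1}" by (rule normal_central)
    thus False using eq wH wnc by blast
  qed
  have xH: "x \<notin> H"
  proof
    assume "x \<in> H"
    hence "H \<subseteq> K" unfolding K_def conj_meet_def by auto
    thus False using KH \<open>K \<noteq> H\<close> by blast
  qed
  obtain m where m: "card H = card K * m"
    using SL2.card_subgroup_dvd[OF subK sub KH] by (elim dvdE)
  have "card K \<noteq> card H"
    using card_subset_eq[OF _ KH] \<open>K \<noteq> H\<close> by auto
  moreover have "card H \<noteq> 0" using wH by (auto simp: card_eq_0_iff)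
  ultimately have m2: "2 \<le> m" using m by (cases m; cases "m - 1") auto
  have growth: "card K * m * (m + 1) \<le> card (S <#>\<^bsub>SL2\<^esub> S <#>\<^bsub>SL2\<^esub> S)"
  proof -
    let ?D = "H <#>\<^bsub>SL2\<^esub> {x} <#>\<^bsub>SL2\<^esub> H"
    have "card K * m * (card K * m) \<le> card ?D * card K"
      using SL2.card_double_coset[OF sub xc] unfolding K_def[symmetric] m by simp
    hence "card K * (card K * m * m) \<le> card K * card ?D" by (simp only: mult_ac)
    hence D: "card K * m * m \<le> card ?D" using k2 by simp
    have "H \<inter> ?D = {}" by (rule SL2.double_coset_disjoint[OF sub xc xH])
    hence "card (H \<union> ?D) = card H + card ?D" by (intro card_Un_disjoint) auto
    moreover have "H \<union> ?D \<subseteq> S <#>\<^bsub>SL2\<^esub> S <#>\<^bsub>SL2\<^esub> S"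
    proof (rule Un_least)
      show "?D \<subseteq> S <#>\<^bsub>SL2\<^esub> S <#>\<^bsub>SL2\<^esub> S"
        using HS xS unfolding set_mult_def by blast
      show "H \<subseteq> S <#>\<^bsub>SL2\<^esub> S <#>\<^bsub>SL2\<^esub> S"
      proof
        fix h assume h: "h \<in> H"
        hence "h = h \<otimes>\<^bsub>SL2\<^esub> \<one>\<^bsub>SL2\<^esub> \<otimes>\<^bsub>SL2\<^esub> \<one>\<^bsub>SL2\<^esub>" by simp
        thus "h \<in> S <#>\<^bsub>SL2\<^esub> S <#>\<^bsub>SL2\<^esub> S"
          using h HS H.one_closed unfolding set_mult_def by blast
      qed
    qed
    hence "card (H \<union> ?D) \<le> card (S <#>\<^bsub>SL2\<^esub> S <#>\<^bsub>SL2\<^esub> S)"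
      by (intro card_mono) simp_all
    ultimately have "card K * m + card K * m * m \<le> card (S <#>\<^bsub>SL2\<^esub> S <#>\<^bsub>SL2\<^esub> S)"
      using D m by linarith
    thus ?thesis by (simp add: algebra_simps)
  qed
  have S_alt: "card S \<le> card K * m + 2 \<or>
    card S \<le> card K * m + card K \<and> x \<otimes>\<^bsub>SL2\<^esub> x \<in> H"
  proof (rule disjE[OF assms(9)])
    assume S: "S = H \<union> {x, inv\<^bsub>SL2\<^esub> x}"
    have "card S \<le> card H + card {x, inv\<^bsub>SL2\<^esub> x}" unfolding S by (rule card_Un_le)
    also have "card {x, inv\<^bsub>SL2\<^esub> x} \<le> 2" by (simp add: card_insert_if)
    finally show ?thesis using m by simp
  next
    assume S: "x [^]\<^bsub>SL2\<^esub> (2::nat) \<in> H \<and> S = H \<union> ((x <#\<^bsub>SL2\<^esub> H) \<inter> (H #>\<^bsub>SL2\<^esub> x))"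
    have "K #>\<^bsub>SL2\<^esub> x = (\<lambda>v. v \<otimes>\<^bsub>SL2\<^esub> x) ` K" by (auto simp: r_coset_def)
    hence "card (K #>\<^bsub>SL2\<^esub> x) \<le> card K" by (simp add: card_image_le)
    moreover have "card S \<le> card H + card (K #>\<^bsub>SL2\<^esub> x)"
      using S card_Un_le[of H "K #>\<^bsub>SL2\<^esub> x"] unfolding coset by simp
    ultimately show ?thesis using S m sq[OF xc] by simp
  qed
  have mono: "real (card S) powr (1 + log 2 3 / 5) \<le> real s powr (1 + log 2 3 / 5)"
    if "card S \<le> s" for s
    using that by (intro powr_mono2) (auto intro: add_nonneg_nonneg)
  have "real (card S) powr (1 + log 2 3 / 5) \<le> real (card K * m * (m + 1))"
  proof (cases "m = 2")
    case True
    have "card S \<le> 2 * card K + 2"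
      using S_alt
    proof (elim disjE conjE)
      \<comment> \<open>Here \<open>K\<close> has index two in \<open>H\<close>, and \<open>x\<close> normalizes it; so it is central and \<open>k = 2\<close>, which makes
          \<open>km + k\<close> equal to \<open>2k + 2\<close>.\<close>
      assume S: "card S \<le> card K * m + card K" and x2: "x \<otimes>\<^bsub>SL2\<^esub> x \<in> H"
      have "inv\<^bsub>SL2\<^esub> s \<otimes>\<^bsub>SL2\<^esub> v \<otimes>\<^bsub>SL2\<^esub> s \<in> K" if "s \<in> {z, w, x}" "v \<in> K" for s v
      proof (cases "s = x")
        case True
        thus ?thesis using SL2.conj_meet_conj_closed[OF sub xc x2] that(2) unfolding K_def by blast
      next
        case False
        hence "s \<in> H" using that(1) zH wH by blast
        thus ?thesis using that(2) m \<open>m = 2\<close>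
          by (intro SL2.index_two_conj_closed[OF subK sub KH]) auto
      qed
      hence "K \<subseteq> {mat 1, - mat 1}" by (rule normal_central)
      hence "card K = 2" using cenK card_cen by (simp add: subset_antisym)
      thus ?thesis using S True by simp
    qed (use True in simp)
    hence "real (card S) powr (1 + log 2 3 / 5) \<le> real (2 * card K + 2) powr (1 + log 2 3 / 5)"
      by (rule mono)
    also have "\<dots> \<le> real (6 * card K)" by (rule small_set_growth[OF k2 k8])
    finally show ?thesis using True by simp
  next
    case False
    have "card S \<le> card K * m + card K" using S_alt k2 by auto
    hence "card S \<le> card K * (m + 1)" by simp
    hence "real (card S) powr (1 + log 2 3 / 5) \<le> real (card K * (m + 1)) powr (1 + log 2 3 / 5)"
      by (rule mono)
    also have "\<dots> \<le> real (card K * m * (m + 1))"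
      using m2 False by (intro large_index_growth[OF k8]) simp
    finally show ?thesis .
  qed
  also have "\<dots> \<le> real (card (S <#>\<^bsub>SL2\<^esub> S <#>\<^bsub>SL2\<^esub> S))"
    using growth by (simp only: of_nat_le_iff)
  finally show ?thesis .
qed

end
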